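(* Let $\mathcal{H}$ be a real finite-dimensional Hilbert space, let $I=\{1,\dots,N\}$, for each $i\in I$ let $f_i\colon\mathcal{H}\to\mathbb{R}$ be convex and differentiable with locally Lipschitz gradient, and let $f(x)=\max_{i\in I} f_i(x)$. Let $(x^k)_{k\in\mathbb{N}}\subset\mathcal{H}$ be a sequence converging to a point $x^*\in\operatorname{argmin} f$. If there exists $k_0\in\mathbb{N}$ such that $I(x^k)=I(x^* )$ for all $k\ge k_0$, then $\operatorname{dist}(0,\partial f(x^k))\to 0$ as $k\to\infty$. Moreover, if $0\in\operatorname{ri}\partial f(x^* )$ and $\Lambda(x^* )$ is a singleton, then the reverse implication also holds: if $\operatorname{dist}(0,\partial f(x^k))\to0$, then there exists $k_0\in\mathbb{N}$ such that $I(x^k)=I(x^* )$ for all $k\ge k_0$.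
   Context: $\Delta^N=\{y\in\mathbb{R}^N : y_i\ge 0\ \forall i,\ \sum_{i=1}^N y_i=1\}$ is the probability simplex and $\phi(x,y)=\sum_{i\in I}y_if_i(x)$. The active set at $x$ is $I(x)=\{i\in I: f_i(x)=f(x)\}$. $\partial f$ is the convex subdifferential, $\operatorname{ri}$ denotes relative interior, and $\operatorname{dist}(x,C)=\inf_{u\in C}\|x-u\|$. A pair $(x^*,y^* )\in\mathcal{H}\times\Delta^N$ is a saddle point of $\phi$ on $\mathcal{H}\times\Delta^N$ if $\phi(x^*,y)\le\phi(x^*,y^* )\le\phi(x,y^* )$ for all $(x,y)\in\mathcal{H}\times\Delta^N$. For $x^*\in\operatorname{argmin}f$, $\Lambda(x^* )=\{y^*\in\Delta^N : (x^*,y^* )\text{ is a saddle point of }\phi\text{ on }\mathcal{H}\times\Delta^N\}$. *)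

theory Defs
  imports "HOL-Analysis.Analysis"
begin

(* The index set {1..N} is a finite type 'n with N = CARD('n), so N \<ge> 1 and R^N is real ^ 'n. *)
definition max_fun :: "('n::finite \<Rightarrow> 'a \<Rightarrow> real) \<Rightarrow> 'a \<Rightarrow> real"
  where "max_fun f x = Max (range (\<lambda>i. f i x))"

definition active_set :: "('n::finite \<Rightarrow> 'a \<Rightarrow> real) \<Rightarrow> 'a \<Rightarrow> 'n set"
  where "active_set f x = {i. f i x = max_fun f x}"

(* For convex F this is the usual convex subdifferential.  The distance of 0 to it is taken with
   infdist, which is 0 (rather than infinite) on the empty set; this case does not occur for
   a maximum of finitely many convex differentiable functions. *)
definition subdifferential :: "('a::real_inner \<Rightarrow> real) \<Rightarrow> 'a \<Rightarrow> 'a set"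
  where "subdifferential F x = {u. \<forall>z. F x + u \<bullet> (z - x) \<le> F z}"

definition locally_lipschitz :: "('a::metric_space \<Rightarrow> 'b::metric_space) \<Rightarrow> bool"
  where "locally_lipschitz g \<longleftrightarrow> (\<forall>x. \<exists>r>0. \<exists>L. L-lipschitz_on (ball x r) g)"

definition prob_simplex :: "(real ^ 'n::finite) set"
  where "prob_simplex = {y. (\<forall>i. 0 \<le> y $ i) \<and> (\<Sum>i\<in>UNIV. y $ i) = 1}"

(* The Lagrangian-type function phi, linear in the weights y. *)
definition weighted_sum :: "('n::finite \<Rightarrow> 'a \<Rightarrow> real) \<Rightarrow> 'a \<Rightarrow> real ^ 'n \<Rightarrow> real"
  where "weighted_sum f x y = (\<Sum>i\<in>UNIV. y $ i * f i x)"

definition saddle_point ::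
    "('a \<Rightarrow> 'b \<Rightarrow> real) \<Rightarrow> 'a set \<Rightarrow> 'b set \<Rightarrow> 'a \<Rightarrow> 'b \<Rightarrow> bool"
  where "saddle_point \<phi> X Y xs ys \<longleftrightarrow> xs \<in> X \<and> ys \<in> Y \<and>
    (\<forall>x\<in>X. \<forall>y\<in>Y. \<phi> xs y \<le> \<phi> xs ys \<and> \<phi> xs ys \<le> \<phi> x ys)"

(* Lambda at a minimizer xs: the y-components of the saddle points of phi whose x-component is xs. *)
definition multiplier_set :: "('n::finite \<Rightarrow> 'a \<Rightarrow> real) \<Rightarrow> 'a \<Rightarrow> (real ^ 'n) set"
  where "multiplier_set f xs =
    {ys \<in> prob_simplex. saddle_point (weighted_sum f) UNIV prob_simplex xs ys}"

end

theory Submission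
  imports Defs
begin

text \<open>
  Everything rests on one description of the subdifferential (\<open>subdifferential_max_fun\<close>): the
  subgradients of \<open>max_fun f\<close> at a point are the convex combinations of the gradients of the
  functions active there. The subdifferential at \<open>x k\<close> is thus the image of a compact face of the
  simplex, which depends only on the active set, under a map that varies continuously with \<open>x k\<close>;
  moving from \<open>xs\<close> to \<open>x k\<close> displaces each point of this image by at most
  \<open>\<Sum>i. norm (grad i (x k) - grad i xs)\<close>, which tends to 0.

  If the active sets agree, weights that represent the subgradient 0 at \<open>xs\<close> are admissible at
  \<open>x k\<close> too, and yield subgradients there that tend to 0.

  For the converse, continuity allows only subsets of the active set at \<open>xs\<close> to occur in the limit,
  and there are finitely many of these, so it suffices to rule out each proper subset \<open>J\<close>. Weights
  that combine the gradients at \<open>xs\<close> to 0 form a saddle point with \<open>xs\<close>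
  (\<open>multiplier_setI\<close>), so there is only one such weight vector. Because 0 is a relative interior
  point, one of them is positive on the whole active set (\<open>zero_rel_interior_positive_weights\<close>).
  Hence none is supported on \<open>J\<close>, the compact set of combinations over \<open>J\<close> keeps a positive
  distance from 0, and so do the subdifferentials at all \<open>x k\<close> close to \<open>xs\<close> with active set
  \<open>J\<close>, which contradicts that their distances to 0 vanish.
\<close>

section \<open>Weights and convex combinations\<close>

text \<open>
  Convex hulls of gradients are parametrized by weight vectors indexed by functions rather than by
  points, since different functions may share a gradient and multipliers distinguish them.
\<close>

definition simplex_face :: "'n::finite set \<Rightarrow> (real ^ 'n) set"
  where "simplex_face J = {y \<in> prob_simplex. \<forall>i. i \<notin> J \<longrightarrow> y $ i = 0}"

definition weighted_combination :: "('n::finite \<Rightarrow> 'a::real_vector) \<Rightarrow> real ^ 'n \<Rightarrow> 'a"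
  where "weighted_combination g y = (\<Sum>i\<in>UNIV. y $ i *\<^sub>R g i)"

lemma linear_weighted_combination: "linear (weighted_combination g)"
  by (rule linearI)
    (simp_all add: weighted_combination_def scaleR_add_left sum.distrib scaleR_sum_right)

lemma simplex_face_nonneg: "y \<in> simplex_face J \<Longrightarrow> 0 \<le> y $ i"
  by (simp add: simplex_face_def prob_simplex_def)

lemma simplex_face_sum: "y \<in> simplex_face J \<Longrightarrow> (\<Sum>i\<in>UNIV. y $ i) = 1"
  by (simp add: simplex_face_def prob_simplex_def)

lemma simplex_face_le_1:
  assumes "y \<in> simplex_face J"
  shows "y $ i \<le> 1"
  using member_le_sum[of i UNIV "\<lambda>i. y $ i"] simplex_face_nonneg[OF assms] simplex_face_sum[OF assms]
  by simp

lemma axis_in_simplex_face: "i \<in> J \<Longrightarrow> axis i 1 \<in> simplex_face J"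
  by (auto simp: simplex_face_def prob_simplex_def axis_def)

lemma convex_simplex_face: "convex (simplex_face J)"
  by (rule convexI)
    (auto simp: simplex_face_def prob_simplex_def sum.distrib simp flip: sum_distrib_left)

lemma compact_simplex_face: "compact (simplex_face J)"
proof -
  have "bounded (simplex_face J)"
  proof (rule boundedI)
    fix y :: "real ^ 'a" assume y: "y \<in> simplex_face J"
    have "norm y \<le> (\<Sum>i\<in>UNIV. \<bar>y $ i\<bar>)" by (rule norm_le_l1_cart)
    also have "\<dots> = 1"
      using simplex_face_nonneg[OF y] simplex_face_sum[OF y] by simp
    finally show "norm y \<le> 1" .
  qed
  moreover have "closed (simplex_face J)"
  proof -
    have "simplex_face J = (\<Inter>i. {y. 0 \<le> y $ i}) \<inter> {y. (\<Sum>i\<in>UNIV. y $ i) = 1}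
        \<inter> (\<Inter>i\<in>-J. {y. y $ i = 0})"
      by (auto simp: simplex_face_def prob_simplex_def)
    moreover have "closed \<dots>"
      by (intro closed_Int closed_INT ballI closed_Collect_le closed_Collect_eq continuous_intros)
    ultimately show ?thesis by simp
  qed
  ultimately show ?thesis by (simp add: compact_eq_bounded_closed)
qed

text \<open>The set is the linear image of a compact convex set of weight vectors.\<close>

lemma compact_convex_weighted_combinations:
  fixes g :: "'n::finite \<Rightarrow> 'a::real_normed_vector"
  shows "compact (weighted_combination g ` simplex_face J)"
    and "convex (weighted_combination g ` simplex_face J)"
proof -
  have "continuous_on (simplex_face J) (weighted_combination g)"
    unfolding weighted_combination_def by (intro continuous_intros)
  then show "compact (weighted_combination g ` simplex_face J)"
    using compact_simplex_face by (rule compact_continuous_image)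
  show "convex (weighted_combination g ` simplex_face J)"
    by (intro convex_linear_image linear_weighted_combination convex_simplex_face)
qed

text \<open>
  The bound is uniform in \<open>y\<close>, so it compares whole sets of combinations although the weights may
  vary along the sequence.
\<close>

lemma norm_weighted_combination_diff_le:
  fixes g h :: "'n::finite \<Rightarrow> 'a::real_normed_vector"
  assumes y: "y \<in> simplex_face J"
  shows "norm (weighted_combination g y - weighted_combination h y) \<le> (\<Sum>i\<in>UNIV. norm (g i - h i))"
proof -
  have "weighted_combination g y - weighted_combination h y = (\<Sum>i\<in>UNIV. y $ i *\<^sub>R (g i - h i))"
    by (simp add: weighted_combination_def scaleR_diff_right sum_subtractf)
  also have "norm \<dots> \<le> (\<Sum>i\<in>UNIV. norm (g i - h i))"
    using simplex_face_nonneg[OF y] simplex_face_le_1[OF y]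
    by (intro sum_norm_le) (simp add: mult_left_le_one_le)
  finally show ?thesis .
qed

text \<open>
  A relative interior point can be pushed slightly away from the barycenter \<open>c\<close> of the generators
  without leaving the set: \<open>- t *\<^sub>R c\<close> is still a combination for some \<open>t > 0\<close>. Mixing its weights
  with those of \<open>c\<close>, which are positive on \<open>J\<close>, represents 0 by weights positive on \<open>J\<close>.
\<close>

lemma zero_rel_interior_positive_weights:
  fixes g :: "'n::finite \<Rightarrow> 'a::real_normed_vector"
  assumes ri: "0 \<in> rel_interior (weighted_combination g ` simplex_face J)"
  shows "\<exists>y\<in>simplex_face J. weighted_combination g y = 0 \<and> (\<forall>i\<in>J. 0 < y $ i)"
proof -
  let ?S = "weighted_combination g ` simplex_face J"
  obtain e where e: "e > 0" "ball 0 e \<inter> affine hull ?S \<subseteq> ?S" and zero: "0 \<in> ?S"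
    using ri by (auto simp: mem_rel_interior_ball)
  from zero obtain w where w: "w \<in> simplex_face J" by auto
  have "J \<noteq> {}"
    using simplex_face_sum[OF w] w by (auto simp: simplex_face_def)
  define b :: "real ^ 'n" where "b = (\<chi> i. if i \<in> J then 1 / card J else 0)"
  have "(\<Sum>i\<in>UNIV. b $ i) = (\<Sum>i\<in>J. 1 / card J)"
    unfolding b_def by (simp add: sum.If_cases)
  then have b: "b \<in> simplex_face J"
    using \<open>J \<noteq> {}\<close> by (simp add: simplex_face_def prob_simplex_def b_def)
  define c where "c = weighted_combination g b"
  \<comment> \<open>The summand 1 keeps the denominator positive even if \<open>c = 0\<close>.\<close>
  define t where "t = e / (2 * (norm c + 1))"
  have t: "t > 0" using e by (simp add: t_def add_nonneg_pos)
  have "norm (- t *\<^sub>R c) = e * (norm c / (2 * (norm c + 1)))"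
    using e(1) by (simp add: t_def)
  also have "\<dots> < e * 1"
    using e(1) by (intro mult_strict_left_mono) (simp_all add: divide_simps add_nonneg_pos add_pos_nonneg)
  finally have "- t *\<^sub>R c \<in> ball 0 e" by simp
  moreover have "(1 + t) *\<^sub>R 0 + (- t) *\<^sub>R c \<in> affine hull ?S"
    using zero b by (intro mem_affine affine_affine_hull hull_inc) (auto simp: c_def)
  ultimately have "- t *\<^sub>R c \<in> ?S" using e(2) by auto
  then obtain y where y: "y \<in> simplex_face J" "weighted_combination g y = - t *\<^sub>R c" by force
  define z where "z = (1 / (1 + t)) *\<^sub>R y + (t / (1 + t)) *\<^sub>R b"
  have "z \<in> simplex_face J"
    unfolding z_def using t
    by (intro convexD[OF convex_simplex_face] y b) (simp_all add: field_simps)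
  moreover have "weighted_combination g z = 0"
    using y(2) by (simp add: z_def linear_add[OF linear_weighted_combination]
        linear_cmul[OF linear_weighted_combination] c_def)
  moreover have "0 < z $ i" if "i \<in> J" for i
  proof -
    have "0 < b $ i" using that by (auto simp: b_def card_gt_0_iff)
    then show ?thesis
      using t simplex_face_nonneg[OF y(1), of i] by (simp add: z_def add_nonneg_pos)
  qed
  ultimately show ?thesis by blast
qed

lemma weighted_combination_bounded_below:
  fixes g :: "'n::finite \<Rightarrow> 'a::real_normed_vector"
  assumes nonzero: "0 \<notin> weighted_combination g ` simplex_face J" and J: "J \<noteq> {}"
  obtains \<delta> where "\<delta> > 0" "\<And>y. y \<in> simplex_face J \<Longrightarrow> \<delta> \<le> norm (weighted_combination g y)"
proof
  let ?S = "weighted_combination g ` simplex_face J"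
  have "closed ?S"
    by (intro compact_imp_closed compact_convex_weighted_combinations)
  moreover have "?S \<noteq> {}" using J axis_in_simplex_face by blast
  ultimately show "infdist 0 ?S > 0" using nonzero by (rule infdist_pos_not_in_closed)
  show "infdist 0 ?S \<le> norm (weighted_combination g y)" if "y \<in> simplex_face J" for y
    using infdist_le[of "weighted_combination g y" ?S 0] that by simp
qed

section \<open>Convex differentiable functions and their maximum\<close>

lemma GDERIV_directional:
  fixes F :: "'a::real_inner \<Rightarrow> real"
  assumes "GDERIV F z :> g"
  shows "((\<lambda>t. (F (z + t *\<^sub>R d) - F z) / t) \<longlongrightarrow> g \<bullet> d) (at_right 0)"
proof -
  have F: "(F has_derivative (\<lambda>h. h \<bullet> g)) (at (z + 0 *\<^sub>R d))"
    using assms by (simp add: gderiv_def)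
  have "((\<lambda>t. z + t *\<^sub>R d) has_derivative (\<lambda>t. t *\<^sub>R d)) (at (0::real))"
    by (auto intro!: derivative_eq_intros)
  from has_derivative_compose[OF this F]
  have "((\<lambda>t. F (z + t *\<^sub>R d)) has_real_derivative (g \<bullet> d)) (at 0)"
    by (simp add: has_field_derivative_def inner_commute mult_commute_abs)
  then have "((\<lambda>t. (F (z + t *\<^sub>R d) - F z) / t) \<longlongrightarrow> g \<bullet> d) (at 0)"
    by (simp add: has_field_derivative_iff)
  then show ?thesis by (rule tendsto_within_subset) simp
qed

lemma GDERIV_isCont:
  fixes F :: "'a::real_inner \<Rightarrow> real"
  shows "GDERIV F z :> g \<Longrightarrow> isCont F z"
  by (simp add: gderiv_def has_derivative_continuous)

text \<open>
  By convexity the difference quotients along the segment to \<open>z\<close> are at most \<open>F z - F x\<close>, and they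
  converge to the directional derivative.
\<close>

lemma convex_gradient_inequality:
  fixes F :: "'a::real_inner \<Rightarrow> real"
  assumes "convex_on UNIV F" and "GDERIV F x :> g"
  shows "F x + g \<bullet> (z - x) \<le> F z"
proof -
  have "\<forall>\<^sub>F t in at_right 0. (F (x + t *\<^sub>R (z - x)) - F x) / t \<le> F z - F x"
    unfolding eventually_at_right_field
  proof (intro exI[of _ 1] conjI allI impI)
    fix t :: real assume t: "0 < t" "t < 1"
    have "F ((1 - t) *\<^sub>R x + t *\<^sub>R z) \<le> (1 - t) * F x + t * F z"
      using assms(1) t by (intro convex_onD) auto
    moreover have "(1 - t) *\<^sub>R x + t *\<^sub>R z = x + t *\<^sub>R (z - x)"
      by (simp add: algebra_simps)
    ultimately show "(F (x + t *\<^sub>R (z - x)) - F x) / t \<le> F z - F x"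
      using t by (simp add: field_simps)
  qed simp
  from tendsto_upperbound[OF GDERIV_directional[OF assms(2)] this] show ?thesis by simp
qed

lemma max_fun_ge: "f i x \<le> max_fun f x"
  by (simp add: max_fun_def)

lemma max_fun_attained: "\<exists>i. max_fun f x = f i x"
proof -
  have "Max (range (\<lambda>i. f i x)) \<in> range (\<lambda>i. f i x)" by (rule Max_in) auto
  then show ?thesis unfolding max_fun_def by (rule rangeE) (rule exI)
qed

lemma active_set_nonempty: "active_set f x \<noteq> {}"
  using max_fun_attained[of f x] by (auto simp: active_set_def)

text \<open>
  An inactive function stays strictly below some active one nearby. The opposite inclusion may fail:
  functions that tie at the limit can separate close to it.
\<close>

lemma eventually_active_set_subset:
  assumes "\<And>i. isCont (f i) z" and "(y \<longlongrightarrow> z) F"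
  shows "\<forall>\<^sub>F k in F. active_set f (y k) \<subseteq> active_set f z"
proof -
  obtain j where j: "max_fun f z = f j z" using max_fun_attained[of f z] by blast
  have "\<forall>\<^sub>F k in F. i \<in> active_set f (y k) \<longrightarrow> i \<in> active_set f z" for i
  proof (cases "i \<in> active_set f z")
    case False
    then have "f i z < f j z"
      using max_fun_ge[of f i z] j by (auto simp: active_set_def)
    moreover have "((\<lambda>k. f j (y k) - f i (y k)) \<longlongrightarrow> f j z - f i z) F"
      by (intro tendsto_diff isCont_tendsto_compose[OF assms(1)] assms(2))
    ultimately have "\<forall>\<^sub>F k in F. 0 < f j (y k) - f i (y k)"
      by (intro order_tendstoD(1)) auto
    then show ?thesis
    proof eventually_elim
      case (elim k)
      then show ?case using max_fun_ge[of f j "y k"] by (auto simp: active_set_def)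
    qed
  qed simp
  then have "\<forall>\<^sub>F k in F. \<forall>i. i \<in> active_set f (y k) \<longrightarrow> i \<in> active_set f z"
    by (rule eventually_all_finite)
  then show ?thesis by eventually_elim auto
qed

lemma weighted_sum_le_max_fun:
  assumes "y \<in> prob_simplex"
  shows "weighted_sum f x y \<le> max_fun f x"
proof -
  have "weighted_sum f x y \<le> (\<Sum>i\<in>UNIV. y $ i * max_fun f x)"
    unfolding weighted_sum_def using assms
    by (intro sum_mono mult_left_mono max_fun_ge) (simp add: prob_simplex_def)
  then show ?thesis using assms by (simp add: prob_simplex_def flip: sum_distrib_right)
qed

lemma weighted_sum_active:
  assumes "y \<in> simplex_face (active_set f x)"
  shows "weighted_sum f x y = max_fun f x"
proof -
  have "weighted_sum f x y = (\<Sum>i\<in>UNIV. y $ i * max_fun f x)"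
    unfolding weighted_sum_def using assms
    by (intro sum.cong) (auto simp: simplex_face_def active_set_def)
  then show ?thesis using simplex_face_sum[OF assms] by (simp flip: sum_distrib_right)
qed

lemma weighted_sum_gradient_inequality:
  fixes f :: "'n::finite \<Rightarrow> 'a::real_inner \<Rightarrow> real"
  assumes "\<And>i. convex_on UNIV (f i)" and "\<And>i. GDERIV (f i) x :> g i" and "y \<in> prob_simplex"
  shows "weighted_sum f x y + weighted_combination g y \<bullet> (z - x) \<le> weighted_sum f z y"
proof -
  have "weighted_sum f x y + weighted_combination g y \<bullet> (z - x)
      = (\<Sum>i\<in>UNIV. y $ i * (f i x + g i \<bullet> (z - x)))"
    by (simp add: weighted_sum_def weighted_combination_def inner_sum_left distrib_left sum.distrib)
  also have "\<dots> \<le> weighted_sum f z y"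
    unfolding weighted_sum_def using assms
    by (intro sum_mono mult_left_mono convex_gradient_inequality) (auto simp: prob_simplex_def)
  finally show ?thesis .
qed

text \<open>
  A combination of active gradients is a subgradient because the weighted sum touches the maximum
  at \<open>x\<close> and minorizes it elsewhere. Conversely, a vector \<open>u\<close> outside the compact convex set of
  combinations is separated from it by the direction \<open>d\<close> from its nearest point: along \<open>d\<close> every
  active function, and therefore the maximum, grows strictly slower than the slope
  \<open>u \<bullet> d\<close> that a subgradient \<open>u\<close> would enforce.
\<close>

proposition subdifferential_max_fun:
  fixes f :: "'n::finite \<Rightarrow> 'a::real_inner \<Rightarrow> real"
  assumes convex: "\<And>i. convex_on UNIV (f i)" and gradient: "\<And>i. GDERIV (f i) x :> g i"
  shows "subdifferential (max_fun f) x = weighted_combination g ` simplex_face (active_set f x)"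
    (is "_ = ?C")
proof (intro equalityI subsetI)
  fix u assume "u \<in> ?C"
  then obtain y where y: "y \<in> simplex_face (active_set f x)" and u: "u = weighted_combination g y"
    by blast
  have simplex: "y \<in> prob_simplex" using y by (simp add: simplex_face_def)
  have "max_fun f x + u \<bullet> (z - x) \<le> max_fun f z" for z
    using weighted_sum_gradient_inequality[of f x g y z, OF convex gradient simplex]
      weighted_sum_le_max_fun[OF simplex, of f z] weighted_sum_active[OF y] u
    by simp
  then show "u \<in> subdifferential (max_fun f) x" by (simp add: subdifferential_def)
next
  fix u assume u: "u \<in> subdifferential (max_fun f) x"
  show "u \<in> ?C"
  proof (rule ccontr)
    assume "u \<notin> ?C"
    have vertex: "g i \<in> ?C" if "i \<in> active_set f x" for i
    proof
      show "g i = weighted_combination g (axis i 1)"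
        by (simp add: weighted_combination_def axis_def if_distrib[of "\<lambda>r. r *\<^sub>R _"] cong: if_cong)
      show "axis i 1 \<in> simplex_face (active_set f x)"
        using that by (rule axis_in_simplex_face)
    qed
    then have "?C \<noteq> {}" using active_set_nonempty[of f x] by blast
    moreover have "continuous_on ?C (dist u)" by (intro continuous_intros)
    ultimately obtain v where v: "v \<in> ?C" "\<forall>w\<in>?C. dist u v \<le> dist u w"
      using continuous_attains_inf[OF compact_convex_weighted_combinations(1)] by metis
    define d where "d = u - v"
    have "d \<noteq> 0" using v \<open>u \<notin> ?C\<close> by (auto simp: d_def)
    have descent: "g i \<bullet> d < u \<bullet> d" if "i \<in> active_set f x" for i
    proof -
      have "(u - v) \<bullet> (g i - v) \<le> 0"
        by (rule any_closest_point_dot[OF _ _ v(1) vertex[OF that] v(2)])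
          (intro compact_imp_closed compact_convex_weighted_combinations)+
      moreover have "u \<bullet> d = v \<bullet> d + d \<bullet> d" by (simp add: d_def algebra_simps)
      moreover have "d \<bullet> d > 0" using \<open>d \<noteq> 0\<close> by simp
      ultimately show ?thesis by (simp add: d_def inner_diff_right inner_commute)
    qed
    have "\<forall>\<^sub>F t in at_right 0. i \<in> active_set f x \<longrightarrow> (f i (x + t *\<^sub>R d) - f i x) / t < u \<bullet> d" for i
      using order_tendstoD(2)[OF GDERIV_directional[OF gradient] descent]
      by (cases "i \<in> active_set f x") auto
    then have "\<forall>\<^sub>F t in at_right 0. \<forall>i. i \<in> active_set f x \<longrightarrow> (f i (x + t *\<^sub>R d) - f i x) / t < u \<bullet> d"
      by (rule eventually_all_finite)
    moreover have "\<forall>\<^sub>F t in at_right 0. active_set f (x + t *\<^sub>R d) \<subseteq> active_set f x"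
    proof (rule eventually_active_set_subset)
      show "isCont (f i) x" for i using gradient by (rule GDERIV_isCont)
      have "((\<lambda>t. x + t *\<^sub>R d) \<longlongrightarrow> x + 0 *\<^sub>R d) (at_right 0)" by (intro tendsto_intros)
      then show "((\<lambda>t. x + t *\<^sub>R d) \<longlongrightarrow> x) (at_right 0)" by simp
    qed
    moreover have "\<forall>\<^sub>F t in at_right (0::real). 0 < t" by (rule eventually_at_right_less)
    ultimately have "\<forall>\<^sub>F t in at_right (0::real). False"
    proof eventually_elim
      case (elim t)
      obtain i where i: "i \<in> active_set f (x + t *\<^sub>R d)"
        using active_set_nonempty[of f "x + t *\<^sub>R d"] by blast
      then have "i \<in> active_set f x" using elim by blast
      then have "max_fun f (x + t *\<^sub>R d) < max_fun f x + t * (u \<bullet> d)"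
        using elim(1)[rule_format, of i] elim(3) i
        by (simp add: active_set_def divide_less_eq algebra_simps)
      moreover have "max_fun f x + u \<bullet> ((x + t *\<^sub>R d) - x) \<le> max_fun f (x + t *\<^sub>R d)"
        using u unfolding subdifferential_def by blast
      ultimately show False by simp
    qed
    then show False by simp
  qed
qed

text \<open>
  The support condition makes \<open>y\<close> a maximizer of the weighted sum at \<open>x\<close>, and stationarity makes
  \<open>x\<close> a minimizer of the convex function weighted by \<open>y\<close>.
\<close>

lemma multiplier_setI:
  fixes f :: "'n::finite \<Rightarrow> 'a::real_inner \<Rightarrow> real"
  assumes "\<And>i. convex_on UNIV (f i)" and "\<And>i. GDERIV (f i) x :> g i"
    and y: "y \<in> simplex_face (active_set f x)" and zero: "weighted_combination g y = 0"
  shows "y \<in> multiplier_set f x"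
proof -
  have simplex: "y \<in> prob_simplex" using y by (simp add: simplex_face_def)
  have "weighted_sum f x y' \<le> weighted_sum f x y" if "y' \<in> prob_simplex" for y'
    using weighted_sum_le_max_fun[OF that] weighted_sum_active[OF y] by simp
  moreover have "weighted_sum f x y \<le> weighted_sum f z y" for z
    using weighted_sum_gradient_inequality[of f x g y z, OF assms(1,2) simplex] zero by simp
  ultimately show ?thesis
    using simplex by (simp add: multiplier_set_def saddle_point_def)
qed

lemma locally_lipschitz_isCont:
  assumes "locally_lipschitz g"
  shows "isCont g z"
proof -
  obtain r L where r: "r > 0" "L-lipschitz_on (ball z r) g"
    using assms unfolding locally_lipschitz_def by blast
  then have "continuous_on (ball z r) g" by (intro lipschitz_on_continuous_on)
  then show ?thesis using r(1) by (simp add: continuous_on_eq_continuous_at)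
qed

section \<open>Active sets and small subgradients\<close>

text \<open>The weights that represent 0 at the limit point are kept fixed along the sequence.\<close>

lemma subgradient_distance_tendsto_0:
  fixes f :: "'n::finite \<Rightarrow> 'a::real_inner \<Rightarrow> real"
  assumes convex: "\<And>i. convex_on UNIV (f i)"
    and gradient: "\<And>i z. GDERIV (f i) z :> grad i z"
    and gradients: "(\<lambda>k. \<Sum>i\<in>UNIV. norm (grad i (x k) - grad i xs)) \<longlonglongrightarrow> 0"
    and stationary: "0 \<in> subdifferential (max_fun f) xs"
    and same: "\<forall>\<^sub>F k in sequentially. active_set f (x k) = active_set f xs"
  shows "(\<lambda>k. infdist 0 (subdifferential (max_fun f) (x k))) \<longlonglongrightarrow> 0"
proof -
  obtain y where y: "y \<in> simplex_face (active_set f xs)"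
      "weighted_combination (\<lambda>i. grad i xs) y = 0"
    using stationary subdifferential_max_fun[OF convex gradient] by force
  have "\<forall>\<^sub>F k in sequentially. infdist 0 (subdifferential (max_fun f) (x k))
      \<le> (\<Sum>i\<in>UNIV. norm (grad i (x k) - grad i xs))"
    using same
  proof eventually_elim
    case (elim k)
    have "weighted_combination (\<lambda>i. grad i (x k)) y \<in> subdifferential (max_fun f) (x k)"
      using y(1) elim subdifferential_max_fun[of f "x k" "\<lambda>i. grad i (x k)", OF convex gradient] by simp
    then have "infdist 0 (subdifferential (max_fun f) (x k))
        \<le> norm (weighted_combination (\<lambda>i. grad i (x k)) y)"
      by (rule infdist_le2) simp
    also have "\<dots> \<le> (\<Sum>i\<in>UNIV. norm (grad i (x k) - grad i xs))"
      using norm_weighted_combination_diff_le[OF y(1), of "\<lambda>i. grad i (x k)" "\<lambda>i. grad i xs"] y(2)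
      by simp
    finally show ?case .
  qed
  then show ?thesis
    by (intro tendsto_sandwich[OF _ _ tendsto_const gradients]) (simp_all add: infdist_nonneg)
qed

text \<open>
  A proper subset \<open>J\<close> of the limiting active set that recurs along the sequence would have to carry
  weights representing 0 at the limit, which uniqueness of the multiplier forbids once the unique
  multiplier is positive on the whole active set.
\<close>

lemma active_set_eventually_constant:
  fixes f :: "'n::finite \<Rightarrow> 'a::real_inner \<Rightarrow> real"
  assumes convex: "\<And>i. convex_on UNIV (f i)"
    and gradient: "\<And>i z. GDERIV (f i) z :> grad i z"
    and converges: "x \<longlonglongrightarrow> xs"
    and gradients: "(\<lambda>k. \<Sum>i\<in>UNIV. norm (grad i (x k) - grad i xs)) \<longlonglongrightarrow> 0"
    and ri: "0 \<in> rel_interior (subdifferential (max_fun f) xs)"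
    and unique: "is_singleton (multiplier_set f xs)"
    and dist: "(\<lambda>k. infdist 0 (subdifferential (max_fun f) (x k))) \<longlonglongrightarrow> 0"
  shows "\<forall>\<^sub>F k in sequentially. active_set f (x k) = active_set f xs"
proof -
  obtain p where p: "p \<in> simplex_face (active_set f xs)"
      "weighted_combination (\<lambda>i. grad i xs) p = 0" "\<forall>i\<in>active_set f xs. 0 < p $ i"
    using zero_rel_interior_positive_weights ri
    unfolding subdifferential_max_fun[OF convex gradient] by blast
  have excluded: "\<forall>\<^sub>F k in sequentially. active_set f (x k) \<noteq> J"
    if J: "J \<subset> active_set f xs" for J
  proof (cases "J = {}")
    case True
    then show ?thesis by (simp add: active_set_nonempty)
  next
    case False
    have "0 \<notin> weighted_combination (\<lambda>i. grad i xs) ` simplex_face J"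
    proof
      assume "0 \<in> weighted_combination (\<lambda>i. grad i xs) ` simplex_face J"
      then obtain q where q: "q \<in> simplex_face J" "weighted_combination (\<lambda>i. grad i xs) q = 0"
        by force
      have "q \<in> simplex_face (active_set f xs)" using q(1) J by (auto simp: simplex_face_def)
      then have "q \<in> multiplier_set f xs" "p \<in> multiplier_set f xs"
        using q p by (auto intro!: multiplier_setI[OF convex gradient])
      then have "q = p" using unique by (metis is_singletonE singletonD)
      moreover obtain i where "i \<in> active_set f xs" "i \<notin> J" using J by blast
      ultimately show False using p(3) q(1) by (force simp: simplex_face_def)
    qed
    then obtain \<delta> where \<delta>: "\<delta> > 0"
      "\<And>y. y \<in> simplex_face J \<Longrightarrow> \<delta> \<le> norm (weighted_combination (\<lambda>i. grad i xs) y)"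
      using weighted_combination_bounded_below[OF _ False] by blast
    have "\<forall>\<^sub>F k in sequentially. (\<Sum>i\<in>UNIV. norm (grad i (x k) - grad i xs)) < \<delta> / 2"
      "\<forall>\<^sub>F k in sequentially. infdist 0 (subdifferential (max_fun f) (x k)) < \<delta> / 2"
      using \<delta>(1) order_tendstoD(2)[OF gradients, of "\<delta> / 2"] order_tendstoD(2)[OF dist, of "\<delta> / 2"]
      by auto
    then show ?thesis
    proof eventually_elim
      case (elim k)
      show ?case
      proof
        assume k: "active_set f (x k) = J"
        let ?S = "subdifferential (max_fun f) (x k)"
        have S: "?S = weighted_combination (\<lambda>i. grad i (x k)) ` simplex_face J"
          using subdifferential_max_fun[of f "x k" "\<lambda>i. grad i (x k)", OF convex gradient] k by simp
        have "\<delta> / 2 \<le> norm u" if in_S: "u \<in> ?S" for u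
        proof -
          obtain y where u: "u = weighted_combination (\<lambda>i. grad i (x k)) y"
            and y: "y \<in> simplex_face J"
            using in_S unfolding S by (rule imageE)
          define v where "v = weighted_combination (\<lambda>i. grad i xs) y"
          have "norm (u - v) < \<delta> / 2"
            using norm_weighted_combination_diff_le[OF y] elim(1) unfolding u v_def
            by (rule le_less_trans)
          moreover have "\<delta> \<le> norm v" using \<delta>(2)[OF y] by (simp add: v_def)
          moreover have "norm v \<le> norm u + norm (u - v)"
            using norm_triangle_sub[of v u] by (simp add: norm_minus_commute)
          ultimately show ?thesis by simp
        qed
        moreover have "?S \<noteq> {}"
          unfolding S using False axis_in_simplex_face by blast
        ultimately have "\<delta> / 2 \<le> infdist 0 ?S"
          unfolding infdist_notempty[OF \<open>?S \<noteq> {}\<close>] by (intro cINF_greatest) simp_all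
        then show False using elim(2) by simp
      qed
    qed
  qed
  have "\<forall>\<^sub>F k in sequentially. \<forall>J. J \<subset> active_set f xs \<longrightarrow> active_set f (x k) \<noteq> J"
  proof (rule eventually_all_finite)
    show "\<forall>\<^sub>F k in sequentially. J \<subset> active_set f xs \<longrightarrow> active_set f (x k) \<noteq> J" for J
      using excluded[of J] by (cases "J \<subset> active_set f xs") simp_all
  qed
  moreover have "\<forall>\<^sub>F k in sequentially. active_set f (x k) \<subseteq> active_set f xs"
    using converges gradient by (intro eventually_active_set_subset GDERIV_isCont)
  ultimately show ?thesis by eventually_elim blast
qed

theorem theorem4p2:
  fixes f :: "'n::finite \<Rightarrow> 'a::real_inner \<Rightarrow> real"
    and grad :: "'n \<Rightarrow> 'a \<Rightarrow> 'a"
    and x :: "nat \<Rightarrow> 'a"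
    and xs :: 'a
  assumes fin_dim: "\<exists>B :: 'a set. finite B \<and> span B = UNIV"
    and convex: "\<And>i. convex_on UNIV (f i)"
    and gradient: "\<And>i z. GDERIV (f i) z :> grad i z"
    and gradient_lipschitz: "\<And>i. locally_lipschitz (grad i)"
    and minimizer: "is_arg_min (max_fun f) (\<lambda>_. True) xs"
    and converges: "x \<longlonglongrightarrow> xs"
  shows "((\<exists>k0. \<forall>k\<ge>k0. active_set f (x k) = active_set f xs)
            \<longrightarrow> (\<lambda>k. infdist 0 (subdifferential (max_fun f) (x k))) \<longlonglongrightarrow> 0)
       \<and> (0 \<in> rel_interior (subdifferential (max_fun f) xs) \<and> is_singleton (multiplier_set f xs)
            \<longrightarrow> (\<lambda>k. infdist 0 (subdifferential (max_fun f) (x k))) \<longlonglongrightarrow> 0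
            \<longrightarrow> (\<exists>k0. \<forall>k\<ge>k0. active_set f (x k) = active_set f xs))"
proof -
  have "(\<lambda>k. grad i (x k)) \<longlonglongrightarrow> grad i xs" for i
    using locally_lipschitz_isCont[OF gradient_lipschitz] converges
    by (rule isCont_tendsto_compose)
  then have "(\<lambda>k. \<Sum>i\<in>UNIV. norm (grad i (x k) - grad i xs))
      \<longlonglongrightarrow> (\<Sum>i\<in>UNIV. norm (grad i xs - grad i xs))"
    by (intro tendsto_intros)
  then have gradients: "(\<lambda>k. \<Sum>i\<in>UNIV. norm (grad i (x k) - grad i xs)) \<longlonglongrightarrow> 0"
    by simp
  have "0 \<in> subdifferential (max_fun f) xs"
    using minimizer by (auto simp: subdifferential_def is_arg_min_def not_less)
  with subgradient_distance_tendsto_0[OF convex gradient gradients]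
    active_set_eventually_constant[OF convex gradient converges gradients]
  show ?thesis unfolding eventually_sequentially by blast
qed

end
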